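(* Let $\mathcal S^*$ denote the set of all Göllnitz-Gordon partitions $\pi$ such that every even part $b$ of $\pi$ satisfies $$b\equiv 2(t(b;\pi)-1)\pmod 4 .$$ Decompose each $\pi\in\mathcal S^*$ into chains $\chi$, and define the weight of a chain $\chi$ of $\pi$ by $$\omega(\chi)=\begin{cases}2,&\text{if }\chi\text{ is an odd chain, }\lambda(\chi)\ge 3,\text{ and }\lambda(\chi)\equiv 2t(\lambda(\chi);\pi)-1\pmod 4,\\ 1,&\text{otherwise.}\end{cases}$$ Define the weight of $\pi$ by $\omega(\pi)=\prod_{\chi}\omega(\chi)$, the product being over all chains $\chi$ of $\pi$. Then for every nonnegative integer $n$, $$Q_0(n)=\sum_{\pi\in\mathcal S^*,\ \sigma(\pi)=n}\omega(\pi).$$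
   Context: $Q_0(n)$ denotes the number of partitions of $n$ into distinct parts $\not\equiv 0\pmod 4$. A Göllnitz-Gordon partition is a partition into parts differing by at least $2$, where the inequality is strict if a part is even (i.e. any two consecutive parts differ by at least $2$, and by more than $2$ if either of them is even). For a partition $\pi$ into parts differing by $\ge 2$, a chain $\chi$ in $\pi$ is a maximal string of parts of $\pi$ in which consecutive ones differ by exactly $2$; every such $\pi$ decomposes uniquely into chains. All parts of a chain have the same parity modulo $2$, and the chain is called odd (resp. even) if its parts are odd (resp. even). $\lambda(\chi)$ is the least part of the chain $\chi$. For a part $b$ of $\pi$, $t(b;\pi)$ is the number of odd parts of $\pi$ that are $<b$. $\sigma(\pi)$ is the sum of the parts of $\pi$. The empty partition is the unique partition of $0$; an empty product equals $1$. *)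

theory Defs
  imports "HOL-Number_Theory.Cong"
begin

(* Every partition considered has distinct parts, so a partition is represented by the finite
   set of its parts; its sum sigma is then \<Sum>P. *)
definition distinct_partition :: "nat set \<Rightarrow> bool" where
  "distinct_partition P \<longleftrightarrow> finite P \<and> (\<forall>p\<in>P. p > 0)"

definition Q0 :: "nat \<Rightarrow> nat" where
  "Q0 n = card {P. distinct_partition P \<and> (\<forall>p\<in>P. \<not> [p = 0] (mod 4)) \<and> \<Sum>P = n}"

definition consecutive_in :: "nat set \<Rightarrow> nat \<Rightarrow> nat \<Rightarrow> bool" where
  "consecutive_in P a b \<longleftrightarrow> a \<in> P \<and> b \<in> P \<and> a < b \<and> \<not> (\<exists>c\<in>P. a < c \<and> c < b)"

definition goellnitz_gordon :: "nat set \<Rightarrow> bool" where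
  "goellnitz_gordon P \<longleftrightarrow> distinct_partition P \<and>
     (\<forall>a b. consecutive_in P a b \<longrightarrow> b \<ge> a + 2 \<and> (even a \<or> even b \<longrightarrow> b > a + 2))"

definition num_odd_below :: "nat \<Rightarrow> nat set \<Rightarrow> nat" where
  "num_odd_below b P = card {p \<in> P. odd p \<and> p < b}"

(* Consecutive refers to consecutive elements of C. If the parts of P differ by at least 2,
   these are also consecutive in P, as no part lies strictly between a and a + 2. *)
definition diff2_string :: "nat set \<Rightarrow> nat set \<Rightarrow> bool" where
  "diff2_string P C \<longleftrightarrow> C \<noteq> {} \<and> C \<subseteq> P \<and> (\<forall>a b. consecutive_in C a b \<longrightarrow> b = a + 2)"

definition part_chains :: "nat set \<Rightarrow> nat set set" where
  "part_chains P = {C. diff2_string P C \<and> \<not> (\<exists>D. diff2_string P D \<and> C \<subset> D)}"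

(* The congruences involving t(b) are over the integers, since 2 (t(b) - 1) can be negative. *)
definition S_star :: "nat set set" where
  "S_star = {P. goellnitz_gordon P \<and>
     (\<forall>b\<in>P. even b \<longrightarrow> [int b = 2 * (int (num_odd_below b P) - 1)] (mod 4))}"

definition chain_weight :: "nat set \<Rightarrow> nat set \<Rightarrow> nat" where
  "chain_weight P C =
     (if (\<forall>p\<in>C. odd p) \<and> Min C \<ge> 3 \<and>
         [int (Min C) = 2 * int (num_odd_below (Min C) P) - 1] (mod 4)
      then 2 else 1)"

definition partition_weight :: "nat set \<Rightarrow> nat" where
  "partition_weight P = (\<Prod>C\<in>part_chains P. chain_weight P C)"

end

theory Submission
  imports Defs "HOL-Library.Infinite_Set"
begin

text \<open>Write a partition as a pair \<open>(A, G)\<close>, with odd parts \<open>2 a + 1\<close> for \<open>a \<in> A\<close> and even parts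
  \<open>2 g\<close> for \<open>g \<in> G\<close>. It lies in \<open>S_star\<close> iff every \<open>g \<in> G\<close> satisfies \<open>g \<notin> A\<close>, \<open>g - 1 \<notin> A\<close> and
  \<open>g - t\<close> odd, where \<open>t\<close> counts the elements of \<open>A\<close> below \<open>g\<close>. The odd chains of weight 2 are the
  maximal runs of consecutive elements of \<open>A\<close> for which the first number \<open>g\<close> after the run also has
  \<open>g - t\<close> odd. Hence the weighted sum counts pairs \<open>(A, H)\<close> where \<open>H\<close> is any finite set of
  non-elements \<open>g\<close> of \<open>A\<close> with \<open>g - t\<close> odd: those with \<open>g - 1 \<notin> A\<close> are the even parts, those with
  \<open>g - 1 \<in> A\<close> choose one of two copies of a chain and cost nothing. Since \<open>v = g - t\<close> is the index of
  \<open>g\<close> among the non-elements of \<open>A\<close>, \<open>H\<close> amounts to a finite set \<open>V\<close> of odd numbers.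

  Shifting \<open>A \<inter> {0..<g}\<close> cyclically by one inside \<open>{0..<g}\<close> changes \<open>\<Sum>A\<close> by \<open>t\<close>, or by \<open>t - g\<close> if
  \<open>g - 1 \<in> A\<close>, which is exactly the cost of \<open>g\<close> minus \<open>v\<close>. It leaves the larger gaps alone, so
  performing these shifts for all \<open>v \<in> V\<close> in ascending order is, for fixed \<open>V\<close>, a bijection
  \<open>A \<mapsto> B\<close> after which each \<open>v\<close> costs \<open>v\<close>: the pair \<open>(B, V)\<close> is the partition into distinct odd
  parts \<open>2 b + 1\<close> and distinct parts \<open>2 v \<equiv> 2 (mod 4)\<close>.\<close>

section \<open>Gaps of a finite set\<close>

definition below :: "nat set \<Rightarrow> nat \<Rightarrow> nat" where
  "below A g = card {a \<in> A. a < g}"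

text \<open>Indices start at 0. For finite \<open>A\<close> the complement is infinite, so every
  index has a gap.\<close>

definition gap :: "nat set \<Rightarrow> nat \<Rightarrow> nat" where
  "gap A v = enumerate (- A) v"

lemma gap_notin: "finite A \<Longrightarrow> gap A v \<notin> A"
  using enumerate_in_set[of "- A" v] by (simp add: gap_def Compl_eq_Diff_UNIV)

lemma strict_mono_gap: "finite A \<Longrightarrow> strict_mono (gap A)"
  by (simp add: gap_def strict_mono_def Compl_eq_Diff_UNIV)

lemma gap_surj: "finite A \<Longrightarrow> g \<notin> A \<Longrightarrow> \<exists>v. gap A v = g"
  using enumerate_Ex[of "- A" g] by (auto simp: gap_def Compl_eq_Diff_UNIV)

text \<open>The numbers below the gap split into the \<open>v\<close> earlier gaps and the elements
  of \<open>A\<close>.\<close>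

lemma gap_eq_add_below:
  assumes "finite A"
  shows "gap A v = v + below A (gap A v)"
proof -
  let ?g = "gap A v"
  have "{x. x \<notin> A \<and> x < ?g} = gap A ` {..<v}"
    using gap_notin[OF assms] gap_surj[OF assms] strict_mono_less[OF strict_mono_gap[OF assms]]
    by fastforce
  then have "card {x. x \<notin> A \<and> x < ?g} = v"
    using strict_mono_gap[OF assms] by (simp add: card_image strict_mono_imp_inj_on)
  moreover have "{..<?g} = {x. x \<notin> A \<and> x < ?g} \<union> {x \<in> A. x < ?g}"
    by auto
  then have "?g = card ({x. x \<notin> A \<and> x < ?g} \<union> {x \<in> A. x < ?g})"
    by (metis card_lessThan)
  ultimately show ?thesis
    unfolding below_def by (subst (asm) card_Un_disjoint) auto
qed

text \<open>The index of a gap is recovered as \<open>g - below A g\<close>. So a gap whose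
  membership and count survive a change of the set keeps its index.\<close>

lemma gap_eqI:
  assumes "finite A" "g \<notin> A" "g = v + below A g"
  shows "gap A v = g"
proof -
  obtain w where w: "gap A w = g"
    using gap_surj[OF assms(1,2)] by blast
  then have "w = v"
    using gap_eq_add_below[OF assms(1), of w] assms(3) by simp
  then show ?thesis using w by simp
qed

section \<open>Cyclic rotation below a gap\<close>

definition rot :: "nat \<Rightarrow> nat \<Rightarrow> nat" where
  "rot g a = (if a + 1 < g then a + 1 else if a + 1 = g then 0 else a)"

lemma inj_rot: "inj (rot g)"
  by (auto simp: inj_def rot_def split: if_splits)

lemma surj_rot: "surj (rot g)"
proof (rule surjI)
  fix y
  \<comment> \<open>The witness is the backward rotation. The guard \<open>g > 0\<close> is there
    because \<open>rot 0\<close> is the identity.\<close>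
  show "rot g (if y = 0 \<and> g > 0 then g - 1 else if y < g then y - 1 else y) = y"
    by (auto simp: rot_def)
qed

lemma rot_eq_self: "g \<le> a \<Longrightarrow> rot g a = a"
  by (simp add: rot_def)

lemma rot_less_iff: "g \<le> h \<Longrightarrow> rot g a < h \<longleftrightarrow> a < h"
  by (auto simp: rot_def)

lemma mem_rot_image_iff: "g \<le> x \<Longrightarrow> x \<in> rot g ` A \<longleftrightarrow> x \<in> A"
  by (metis inj_rot inj_image_mem_iff rot_eq_self)

lemma below_rot_image:
  assumes "g \<le> h"
  shows "below (rot g ` A) h = below A h"
proof -
  have "{a \<in> rot g ` A. a < h} = rot g ` {a \<in> A. a < h}"
    using rot_less_iff[OF assms] by auto
  then show ?thesis
    unfolding below_def by (simp add: card_image inj_on_subset[OF inj_rot])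
qed

text \<open>Each element below \<open>g\<close> rises by 1, except that \<open>g - 1\<close> drops
  to 0, which is a rise by 1 followed by a loss of \<open>g\<close>. The loss is added on the left
  to avoid truncated subtraction.\<close>

lemma sum_rot_image:
  assumes "finite A" "g > 0"
  shows "\<Sum>(rot g ` A) + (if g - 1 \<in> A then g else 0) = \<Sum>A + below A g"
proof -
  have "\<Sum>(rot g ` A) = (\<Sum>a\<in>A. rot g a)"
    by (simp add: sum.reindex inj_on_subset[OF inj_rot])
  moreover have "(if g - 1 \<in> A then g else 0) = (\<Sum>a\<in>A. if a = g - 1 then g else 0)"
    using assms by simp
  moreover have "below A g = (\<Sum>a\<in>A. if a < g then 1 else 0)"
    using assms by (simp add: below_def sum.If_cases Int_def)
  moreover have "(\<Sum>a\<in>A. rot g a) + (\<Sum>a\<in>A. if a = g - 1 then g else 0)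
      = \<Sum>A + (\<Sum>a\<in>A. if a < g then 1 else 0)"
    using assms unfolding sum.distrib[symmetric] by (intro sum.cong) (auto simp: rot_def)
  ultimately show ?thesis by simp
qed

section \<open>Rotations at indexed gaps\<close>

definition step :: "nat \<Rightarrow> nat set \<Rightarrow> nat set" where
  "step v A = rot (gap A v) ` A"

text \<open>The share in half the sum of a partition of a mark at \<^term>\<open>g\<close>: the mark stands for the
  part \<^term>\<open>2 * g\<close> if \<^term>\<open>g - 1 \<notin> A\<close>, and for one of the two copies of a chain of weight 2
  with greatest part \<^term>\<open>2 * g - 1\<close> otherwise.\<close>

definition mark_cost :: "nat set \<Rightarrow> nat \<Rightarrow> nat" where
  "mark_cost A g = (if g - 1 \<in> A then 0 else g)"

lemma finite_step: "finite A \<Longrightarrow> finite (step v A)"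
  by (simp add: step_def)

lemma card_step: "card (step v A) = card A"
  by (simp add: step_def card_image inj_on_subset[OF inj_rot])

text \<open>The rotation only permutes the numbers below \<open>gap A w\<close>, hence preserves
  membership of \<open>gap A v\<close> and the count below it. The case \<open>w = v\<close> is
  included: the gap used for the rotation survives it.\<close>

lemma gap_step:
  assumes "finite A" "w \<le> v"
  shows "gap (step w A) v = gap A v"
proof (rule gap_eqI[OF finite_step[OF assms(1)]])
  have le: "gap A w \<le> gap A v"
    using assms strict_mono_less_eq[OF strict_mono_gap] by blast
  show "gap A v \<notin> step w A"
    using le gap_notin assms(1) by (simp add: step_def mem_rot_image_iff)
  show "gap A v = v + below (step w A) (gap A v)"
    using le gap_eq_add_below[OF assms(1)] by (simp add: step_def below_rot_image)
qed

text \<open>The cost looks at the predecessor of the gap, so the inequality must be strict: the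
  predecessor is then at least \<open>gap A w\<close>, outside the rotated range.\<close>

lemma mark_cost_step:
  assumes "finite A" "w < v"
  shows "mark_cost (step w A) (gap (step w A) v) = mark_cost A (gap A v)"
proof -
  have "gap A w < gap A v"
    using assms strict_mono_less[OF strict_mono_gap] by blast
  then have "gap A w \<le> gap A v - 1" by simp
  then show ?thesis
    using assms by (simp add: mark_cost_def gap_step) (simp add: step_def mem_rot_image_iff)
qed

text \<open>With \<open>g = v + below A g\<close>, the sum changes by
  \<open>below A g = g - v\<close>, or by \<open>below A g - g = - v\<close> if \<open>g - 1\<close>
  wraps to 0. Both are the cost minus \<open>v\<close>. A positive \<open>v\<close> makes
  \<open>g\<close> positive, so \<open>g - 1\<close> is a true predecessor.\<close>

lemma sum_step:
  assumes "finite A" "v > 0"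
  shows "\<Sum>(step v A) + v = \<Sum>A + mark_cost A (gap A v)"
proof -
  have g: "gap A v = v + below A (gap A v)"
    using assms gap_eq_add_below by blast
  then have "gap A v > 0" using assms by linarith
  from sum_rot_image[OF assms(1) this] g show ?thesis
    by (auto simp: step_def mark_cost_def split: if_splits)
qed

text \<open>By \<open>gap_step\<close> with \<open>w = v\<close>, the rotation point can be read off
  the image, so the rotation can be undone.\<close>

lemma bij_betw_step: "bij_betw (step v) {A. finite A} {A. finite A}"
proof (rule bij_betw_imageI)
  show "inj_on (step v) {A. finite A}"
    unfolding inj_on_def
    by (metis (no_types) gap_step inj_image_eq_iff inj_rot mem_Collect_eq order_refl step_def)
  have "B \<in> step v ` {A. finite A}" if "finite B" for B
  proof
    define g where "g = gap B v"
    define A where "A = rot g -` B"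
    have B: "B = rot g ` A"
      unfolding A_def using surj_rot by (simp add: surj_image_vimage_eq)
    show fin: "A \<in> {A. finite A}"
      using that finite_vimageI[OF that inj_rot] by (simp add: A_def)
    have "g \<notin> B" "g = v + below B g"
      unfolding g_def using that gap_notin gap_eq_add_below by blast+
    then have "gap A v = g"
      using fin by (intro gap_eqI) (simp_all add: B mem_rot_image_iff below_rot_image)
    then show "B = step v A"
      by (simp add: step_def B)
  qed
  then show "step v ` {A. finite A} = {A. finite A}"
    using finite_step by blast
qed

lemma card_fold_step: "card (fold step vs A) = card A"
  by (induction vs arbitrary: A) (simp_all add: card_step)

lemma bij_betw_fold_step: "bij_betw (fold step vs) {A. finite A} {A. finite A}"
proof (induction vs)
  case (Cons v vs)
  then show ?case
    using bij_betw_trans[OF bij_betw_step[of v] Cons.IH] by (simp add: comp_def)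
qed (simp add: bij_betw_def)

text \<open>Ascending order matters: a rotation leaves the costs at all larger indices unchanged, so
  every step is charged the cost in the original set.\<close>

lemma sum_fold_step:
  assumes "finite A" "sorted_wrt (<) vs" "\<forall>v\<in>set vs. v > 0"
  shows "\<Sum>(fold step vs A) + sum_list vs = \<Sum>A + (\<Sum>v\<leftarrow>vs. mark_cost A (gap A v))"
  using assms
proof (induction vs arbitrary: A)
  case (Cons v vs)
  have "\<Sum>(fold step vs (step v A)) + sum_list vs
      = \<Sum>(step v A) + (\<Sum>w\<leftarrow>vs. mark_cost (step v A) (gap (step v A) w))"
    using Cons finite_step by simp
  also have "(\<Sum>w\<leftarrow>vs. mark_cost (step v A) (gap (step v A) w)) = (\<Sum>w\<leftarrow>vs. mark_cost A (gap A w))"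
    using Cons.prems by (intro arg_cong[where f = sum_list] map_cong) (auto simp: mark_cost_step)
  finally show ?case
    using sum_step[of A v] Cons.prems by simp
qed simp

definition rotate_all :: "nat set \<Rightarrow> nat set \<Rightarrow> nat set" where
  "rotate_all V = fold step (sorted_list_of_set V)"

lemma sum_rotate_all:
  assumes "finite A" "finite V" "\<forall>v\<in>V. v > 0"
  shows "\<Sum>(rotate_all V A) + \<Sum>V = \<Sum>A + (\<Sum>v\<in>V. mark_cost A (gap A v))"
proof -
  have "\<Sum>V = sum_list (sorted_list_of_set V)"
    using assms(2) by (metis distinct_sorted_list_of_set set_sorted_list_of_set
        sum_list_distinct_conv_sum_set list.map_ident)
  moreover have "(\<Sum>v\<in>V. mark_cost A (gap A v)) =
      (\<Sum>v\<leftarrow>sorted_list_of_set V. mark_cost A (gap A v))"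
    using assms(2) by (simp add: sum_list_distinct_conv_sum_set)
  ultimately show ?thesis
    using sum_fold_step[of A "sorted_list_of_set V"] assms by (simp add: rotate_all_def)
qed

section \<open>Chains\<close>

text \<open>The last index is \<open>k\<close>, so there are \<open>k + 1\<close> terms and the set
  is never empty.\<close>

definition progression :: "nat \<Rightarrow> nat \<Rightarrow> nat set" where
  "progression a k = (\<lambda>i. a + 2 * i) ` {..k}"

lemma Min_progression: "Min (progression a k) = a"
  by (rule Min_eqI) (auto simp: progression_def)

lemma Max_progression: "Max (progression a k) = a + 2 * k"
  by (rule Max_eqI) (auto simp: progression_def)

lemma progression_Suc: "progression a (Suc k) = insert (a + 2 * Suc k) (progression a k)"
  by (simp add: progression_def atMost_Suc)

lemma progression_below: "progression a (Suc k) = insert a (progression (a + 2) k)"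
  by (simp only: progression_def atMost_Suc_eq_insert_0 image_insert image_image) simp

lemma consecutive_in_progression: "consecutive_in (progression a k) x y \<Longrightarrow> y = x + 2"
proof -
  assume "consecutive_in (progression a k) x y"
  then obtain i j where ij: "x = a + 2 * i" "y = a + 2 * j" "j \<le> k" "x < y"
    and no: "\<not> (\<exists>c\<in>progression a k. x < c \<and> c < y)"
    by (auto simp: consecutive_in_def progression_def)
  have "a + 2 * Suc i \<in> progression a k"
    using ij by (auto simp: progression_def simp del: mult_Suc_right)
  then have "\<not> a + 2 * Suc i < y"
    using no ij by auto
  then show ?thesis using ij by simp
qed

text \<open>Induction on the greatest element: consecutive pairs of \<open>C\<close> stay
  consecutive when the larger \<open>b\<close> joins, and the new pair \<open>Max C\<close>,
  \<open>b\<close> forces \<open>b\<close> to be the next term.\<close>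

lemma ex_progression:
  assumes "finite C" "C \<noteq> {}" "\<And>a b. consecutive_in C a b \<Longrightarrow> b = a + 2"
  shows "\<exists>a k. C = progression a k"
  using assms
proof (induction C rule: finite_linorder_max_induct)
  case (insert b C)
  show ?case
  proof (cases "C = {}")
    case True
    then have "insert b C = progression b 0" by (simp add: progression_def)
    then show ?thesis by blast
  next
    case False
    have "consecutive_in (insert b C) x y" if "consecutive_in C x y" for x y
      using that insert.hyps(2) unfolding consecutive_in_def
      by (metis insert_iff order.asym)
    then have "\<exists>a k. C = progression a k"
      using insert.prems(2) by (intro insert.IH False) blast
    then obtain a k where C: "C = progression a k"
      by blast
    have "consecutive_in (insert b C) (Max C) b"
      using insert.hyps False
      by (auto simp: consecutive_in_def dest: Max_ge)
    from insert.prems(2)[OF this] have "b = a + 2 * Suc k"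
      by (simp add: C Max_progression)
    then have "insert b C = progression a (Suc k)"
      by (simp only: C progression_Suc)
    then show ?thesis
      by blast
  qed
qed simp

lemma diff2_string_iff:
  assumes "finite P"
  shows "diff2_string P C \<longleftrightarrow> C \<subseteq> P \<and> (\<exists>a k. C = progression a k)"
proof -
  have "diff2_string P (progression a k)" if "progression a k \<subseteq> P" for a k
    using that consecutive_in_progression[of a k]
    by (auto simp: diff2_string_def) (simp add: progression_def)
  moreover have "\<exists>a k. C = progression a k" if "diff2_string P C"
    using that finite_subset[OF _ assms] by (intro ex_progression) (auto simp: diff2_string_def)
  ultimately show ?thesis
    by (auto simp: diff2_string_def)
qed

text \<open>A string is maximal as soon as it cannot be extended by one term at either end. The
  guard \<open>a \<ge> 2\<close> protects against truncated subtraction.\<close>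

lemma part_chains_iff:
  assumes "finite P"
  shows "C \<in> part_chains P \<longleftrightarrow> (\<exists>a k. C = progression a k \<and> C \<subseteq> P \<and>
    a + 2 * Suc k \<notin> P \<and> (a \<ge> 2 \<longrightarrow> a - 2 \<notin> P))" (is "_ \<longleftrightarrow> ?R")
proof
  assume C: "C \<in> part_chains P"
  then obtain a k where ak: "C = progression a k" "C \<subseteq> P"
    by (auto simp: part_chains_def diff2_string_iff[OF assms])
  have max: "\<not> C \<subset> progression b l" if "progression b l \<subseteq> P" for b l
    using C that unfolding part_chains_def diff2_string_iff[OF assms] by blast
  have "a + 2 * Suc k \<notin> P"
  proof
    assume "a + 2 * Suc k \<in> P"
    then have "progression a (Suc k) \<subseteq> P"
      using ak by (simp add: progression_Suc)
    moreover have "a + 2 * Suc k \<notin> C"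
      using ak by (auto simp: progression_def)
    then have "C \<subset> progression a (Suc k)"
      using ak(1) by (auto simp only: progression_Suc)
    ultimately show False using max by blast
  qed
  moreover have "a - 2 \<notin> P" if "a \<ge> 2"
  proof
    have a: "progression (a - 2) (Suc k) = insert (a - 2) C"
    proof -
      have "a - 2 + 2 = a" using that by simp
      then show ?thesis using progression_below[of "a - 2" k] ak(1) by (simp only:)
    qed
    assume "a - 2 \<in> P"
    then have "progression (a - 2) (Suc k) \<subseteq> P"
      using ak a by simp
    moreover have "a - 2 \<notin> C"
      using ak that by (auto simp: progression_def)
    then have "C \<subset> progression (a - 2) (Suc k)"
      using a by blast
    ultimately show False using max by blast
  qed
  ultimately show ?R using ak by blast
next
  assume ?R
  then obtain a k where ak: "C = progression a k" "C \<subseteq> P" "a + 2 * Suc k \<notin> P"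
    "a \<ge> 2 \<longrightarrow> a - 2 \<notin> P" by blast
  \<comment> \<open>A larger progression would start earlier or end later, and so contain one of the
    two excluded neighbours of \<open>C\<close>.\<close>
  have "progression b l \<subseteq> C" if sub: "C \<subseteq> progression b l" "progression b l \<subseteq> P" for b l
  proof -
    have "a \<in> C" "a + 2 * k \<in> C" by (auto simp: ak(1) progression_def)
    then have "a \<in> progression b l" "a + 2 * k \<in> progression b l"
      using sub(1) by auto
    then obtain i j where i: "a = b + 2 * i" "i \<le> l" and j: "a + 2 * k = b + 2 * j" "j \<le> l"
      unfolding progression_def by blast
    have "i = 0"
    proof (rule ccontr)
      assume "i \<noteq> 0"
      then have "a \<ge> 2" "a - 2 = b + 2 * (i - 1)" using i by auto
      moreover from this have "a - 2 \<in> progression b l" using i by (auto simp: progression_def)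
      ultimately show False using ak(4) sub(2) by blast
    qed
    moreover have "j = l"
    proof (rule ccontr)
      assume "j \<noteq> l"
      then have "b + 2 * Suc j \<in> progression b l"
        using j(2) by (auto simp: progression_def simp del: mult_Suc_right)
      moreover have "b + 2 * Suc j = a + 2 * Suc k" using j by simp
      ultimately show False using ak(3) sub(2) by auto
    qed
    ultimately show ?thesis using i j by (simp add: ak(1))
  qed
  then show "C \<in> part_chains P"
    using ak(1,2) unfolding part_chains_def diff2_string_iff[OF assms] by blast
qed

section \<open>Halving the parts\<close>

definition odd_half :: "nat set \<Rightarrow> nat set" where
  "odd_half P = {a. 2 * a + 1 \<in> P}"

definition even_half :: "nat set \<Rightarrow> nat set" where
  "even_half P = {g. 2 * g \<in> P}"

definition join :: "nat set \<Rightarrow> nat set \<Rightarrow> nat set" where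
  "join A G = (\<lambda>a. 2 * a + 1) ` A \<union> (\<lambda>g. 2 * g) ` G"

lemma odd_half_join [simp]: "odd_half (join A G) = A"
proof -
  have "2 * a + 1 \<noteq> 2 * g" for a g :: nat by presburger
  then show ?thesis by (auto simp: odd_half_def join_def)
qed

lemma even_half_join [simp]: "even_half (join A G) = G"
proof -
  have "2 * g \<noteq> 2 * a + 1" for a g :: nat by presburger
  then show ?thesis by (auto simp: even_half_def join_def)
qed

lemma join_halves [simp]: "join (odd_half P) (even_half P) = P"
proof -
  have "p \<in> join (odd_half P) (even_half P)" if "p \<in> P" for p
    using that by (cases "even p") (auto simp: odd_half_def even_half_def join_def elim!: evenE oddE)
  then show ?thesis
    by (auto simp: odd_half_def even_half_def join_def)
qed

lemma finite_join_iff: "finite (join A G) \<longleftrightarrow> finite A \<and> finite G"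
  by (simp add: join_def finite_image_iff inj_on_def)

lemma finite_halves:
  assumes "finite P"
  shows "finite (odd_half P)" "finite (even_half P)"
  using assms finite_join_iff[of "odd_half P" "even_half P"] by auto

lemma sum_join:
  assumes "finite A" "finite G"
  shows "\<Sum>(join A G) = 2 * \<Sum>A + card A + 2 * \<Sum>G"
proof -
  have "\<Sum>(join A G) = \<Sum>((\<lambda>a. 2 * a + 1) ` A) + \<Sum>((\<lambda>g. 2 * g) ` G)"
  proof -
    have "2 * a + 1 \<noteq> 2 * g" for a g :: nat by presburger
    then show ?thesis
      unfolding join_def using assms by (intro sum.union_disjoint) auto
  qed
  also have "\<Sum>((\<lambda>a. 2 * a + 1) ` A) = (\<Sum>a\<in>A. 2 * a + 1)"
    by (simp add: sum.reindex inj_on_def)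
  also have "\<Sum>((\<lambda>g. 2 * g) ` G) = (\<Sum>g\<in>G. 2 * g)"
    by (simp add: sum.reindex inj_on_def)
  finally show ?thesis
    by (simp add: sum.distrib sum_distrib_left sum_Suc)
qed

lemma num_odd_below_eq:
  shows "num_odd_below (2 * g) P = below (odd_half P) g"
    and "num_odd_below (2 * g + 1) P = below (odd_half P) g"
proof -
  have "{p \<in> P. odd p \<and> p < 2 * g} = (\<lambda>a. 2 * a + 1) ` {a \<in> odd_half P. a < g}"
    by (auto simp: odd_half_def elim!: oddE)
  moreover have "{p \<in> P. odd p \<and> p < 2 * g + 1} = (\<lambda>a. 2 * a + 1) ` {a \<in> odd_half P. a < g}"
    by (auto simp: odd_half_def elim!: oddE)
  ultimately show "num_odd_below (2 * g) P = below (odd_half P) g"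
    "num_odd_below (2 * g + 1) P = below (odd_half P) g"
    by (simp_all add: num_odd_below_def below_def card_image inj_on_def)
qed

text \<open>Halving a congruence modulo 4 leaves one modulo 2. The condition on even parts and that
  on chains of weight 2 thereby become the same parity condition.\<close>

lemma cong_even_part_iff: "[int (2 * g) = 2 * (int t - 1)] (mod 4) \<longleftrightarrow> odd (g + t)"
  unfolding cong_def by presburger

lemma cong_odd_part_iff: "[int (2 * a + 1) = 2 * int t - 1] (mod 4) \<longleftrightarrow> odd (a + t)"
  unfolding cong_def by presburger

lemma below_Suc:
  assumes "finite A"
  shows "below A (Suc g) = below A g + (if g \<in> A then 1 else 0)"
proof -
  have "{a \<in> A. a < Suc g} = {a \<in> A. a < g} \<union> (if g \<in> A then {g} else {})"
    by (auto simp: less_Suc_eq)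
  then show ?thesis using assms by (simp add: below_def)
qed

lemma below_add:
  assumes "finite A" "\<And>i. i < k \<Longrightarrow> a + i \<in> A"
  shows "below A (a + k) = below A a + k"
  using assms by (induction k) (auto simp: below_Suc)

text \<open>These are the first numbers after maximal runs in \<open>A\<close>, subject to the
  parity condition. Zero is excluded, since there \<open>g - 1\<close> truncates to \<open>g\<close>
  itself.\<close>

definition marked_ends :: "nat set \<Rightarrow> nat set" where
  "marked_ends A = {g. g \<notin> A \<and> g - 1 \<in> A \<and> odd (g + below A g)}"

lemma finite_marked_ends:
  assumes "finite A"
  shows "finite (marked_ends A)"
proof (rule finite_subset)
  show "marked_ends A \<subseteq> insert 0 (Suc ` A)"
  proof
    fix g assume "g \<in> marked_ends A"
    then show "g \<in> insert 0 (Suc ` A)" by (cases g) (auto simp: marked_ends_def)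
  qed
qed (use assms in simp)

text \<open>The two non-membership conditions keep the odd parts \<open>2 * g + 1\<close> and
  \<open>2 * g - 1\<close> away from \<open>2 * g\<close>. Even parts at distance 2 need no
  condition of their own: parity already forbids them.\<close>

lemma S_star_iff:
  "P \<in> S_star \<longleftrightarrow> finite P \<and> (\<forall>g\<in>even_half P. g \<notin> odd_half P \<and> g - 1 \<notin> odd_half P \<and>
     odd (g + below (odd_half P) g))" (is "_ \<longleftrightarrow> ?R")
proof
  assume P: "P \<in> S_star"
  then have fin: "finite P" and pos: "\<And>p. p \<in> P \<Longrightarrow> p > 0"
    and gg: "\<And>a b. consecutive_in P a b \<Longrightarrow> b \<ge> a + 2 \<and> (even a \<or> even b \<longrightarrow> b > a + 2)"
    by (auto simp: S_star_def goellnitz_gordon_def distinct_partition_def)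
  have "g \<notin> odd_half P \<and> g - 1 \<notin> odd_half P \<and> odd (g + below (odd_half P) g)"
    if g: "2 * g \<in> P" for g
  proof (intro conjI notI)
    assume "g \<in> odd_half P"
    then have "consecutive_in P (2 * g) (2 * g + 1)"
      using g by (auto simp: consecutive_in_def odd_half_def)
    from gg[OF this] show False by simp
  next
    assume "g - 1 \<in> odd_half P"
    moreover have "g > 0" using pos[OF g] by simp
    ultimately have "consecutive_in P (2 * (g - 1) + 1) (2 * g)"
      using g by (auto simp: consecutive_in_def odd_half_def)
    from gg[OF this] \<open>g > 0\<close> show False by auto
  next
    assume "even (g + below (odd_half P) g)"
    moreover have "\<And>b. b \<in> P \<Longrightarrow> even b \<Longrightarrow> [int b = 2 * (int (num_odd_below b P) - 1)] (mod 4)"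
      using P unfolding S_star_def by blast
    from this[OF g] have "[int (2 * g) = 2 * (int (num_odd_below (2 * g) P) - 1)] (mod 4)"
      by simp
    ultimately show False
      unfolding cong_even_part_iff num_odd_below_eq by blast
  qed
  then show ?R using fin by (simp add: even_half_def)
next
  assume R: ?R
  let ?A = "odd_half P"
  have g: "g \<notin> ?A \<and> g - 1 \<notin> ?A \<and> odd (g + below ?A g)" if "2 * g \<in> P" for g
    using R that by (simp add: even_half_def)
  \<comment> \<open>The parity condition fails at \<open>g = 0\<close>, as nothing lies below
    0.\<close>
  have "0 \<notin> P"
    using g[of 0] by (auto simp: below_def)
  then have "distinct_partition P"
    using R by (metis distinct_partition_def gr0I)
  moreover have "b \<ge> a + 2 \<and> (even a \<or> even b \<longrightarrow> b > a + 2)" if con: "consecutive_in P a b" for a b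
  proof -
    have ab: "a \<in> P" "b \<in> P" "a < b" and no: "\<And>c. c \<in> P \<Longrightarrow> a < c \<Longrightarrow> c < b \<Longrightarrow> False"
      using con by (auto simp: consecutive_in_def)
    consider i j where "a = 2 * i" "b = 2 * j" | i j where "a = 2 * i" "b = 2 * j + 1"
      | i j where "a = 2 * i + 1" "b = 2 * j" | i j where "a = 2 * i + 1" "b = 2 * j + 1"
      by (metis evenE oddE)
    then show ?thesis
    proof cases
      case 1
      \<comment> \<open>No odd part separates consecutive even parts, so both see the same count,
        and parity makes \<open>i + j\<close> even.\<close>
      have "{x \<in> ?A. x < j} = {x \<in> ?A. x < i}"
      proof -
        have "x < i" if "2 * x + 1 \<in> P" "x < j" for x
          using no[OF that(1)] that(2) 1 by (cases "x < i") simp_all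
        then show ?thesis using 1 ab by (auto simp: odd_half_def)
      qed
      then have "below ?A j = below ?A i" by (simp add: below_def)
      then have "even (i + j)" using g[of i] g[of j] ab 1 by auto
      then have "j \<noteq> i + 1" by auto
      then show ?thesis using 1 ab by simp
    next
      case 2
      then have "j \<noteq> i" using g[of i] ab by (auto simp: odd_half_def)
      then show ?thesis using 2 ab by simp
    next
      case 3
      then have "j \<noteq> i + 1" using g[of j] ab by (auto simp: odd_half_def)
      then show ?thesis using 3 ab by simp
    next
      case 4
      then show ?thesis using ab by simp
    qed
  qed
  moreover have "[int b = 2 * (int (num_odd_below b P) - 1)] (mod 4)" if b: "b \<in> P" "even b" for b
  proof -
    obtain i where "b = 2 * i" using b by blast
    then show ?thesis
      using g[of i] b(1) unfolding \<open>b = 2 * i\<close> cong_even_part_iff num_odd_below_eq by blast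
  qed
  ultimately show "P \<in> S_star"
    by (simp add: S_star_def goellnitz_gordon_def)
qed

section \<open>Chains of weight 2 as runs of consecutive elements\<close>

lemma weighty_chain_iff:
  assumes "finite P"
  defines "A \<equiv> odd_half P"
  shows "C \<in> part_chains P \<and> (\<forall>p\<in>C. odd p) \<and> Min C \<ge> 3 \<and>
      [int (Min C) = 2 * int (num_odd_below (Min C) P) - 1] (mod 4) \<longleftrightarrow>
    (\<exists>a k. C = progression (2 * a + 1) k \<and> (\<forall>i\<le>k. a + i \<in> A) \<and> a + Suc k \<notin> A \<and>
      (a > 0 \<longrightarrow> a - 1 \<notin> A) \<and> odd (a + below A a))" (is "?L \<longleftrightarrow> ?R")
proof -
  have sub: "progression (2 * a + 1) k \<subseteq> P \<longleftrightarrow> (\<forall>i\<le>k. a + i \<in> A)" for a k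
    by (auto simp: progression_def A_def odd_half_def algebra_simps)
  have next_iff: "2 * a + 1 + 2 * Suc k \<in> P \<longleftrightarrow> a + Suc k \<in> A" for a k
    by (simp add: A_def odd_half_def)
  have prev: "(2 * a + 1 \<ge> 2 \<longrightarrow> 2 * a + 1 - 2 \<notin> P) \<longleftrightarrow> (a > 0 \<longrightarrow> a - 1 \<notin> A)" for a
    by (cases a) (simp_all add: A_def odd_half_def)
  \<comment> \<open>This yields the bound \<open>Min C \<ge> 3\<close>: parity rules out a chain
    starting at the part 1.\<close>
  have pos: "a > 0" if "odd (a + below A a)" for a
    using that by (cases a) (auto simp: below_def)
  have cong: "[int (2 * a + 1) = 2 * int (num_odd_below (2 * a + 1) P) - 1] (mod 4) \<longleftrightarrow>
      odd (a + below A a)" for a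
    unfolding cong_odd_part_iff num_odd_below_eq A_def ..
  show ?thesis
  proof
    assume L: ?L
    obtain c k where c: "C = progression c k" "C \<subseteq> P" "c + 2 * Suc k \<notin> P"
      "c \<ge> 2 \<longrightarrow> c - 2 \<notin> P"
      using conjunct1[OF L] unfolding part_chains_iff[OF assms(1)] by (elim exE conjE)
    have "c \<in> C" by (auto simp: c(1) progression_def)
    then have "odd c" using L by blast
    then obtain a where a: "c = 2 * a + 1" by (rule oddE)
    have "odd (a + below A a)"
      using L unfolding c(1) Min_progression a cong by (elim conjE)
    moreover have "\<forall>i\<le>k. a + i \<in> A" "a + Suc k \<notin> A" "a > 0 \<longrightarrow> a - 1 \<notin> A"
      using c(2-4) unfolding c(1) a sub next_iff prev .
    ultimately show ?R
      using c(1) unfolding a by (intro exI conjI)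
  next
    assume ?R
    then obtain a k where C: "C = progression (2 * a + 1) k" and A: "\<forall>i\<le>k. a + i \<in> A"
      "a + Suc k \<notin> A" "a > 0 \<longrightarrow> a - 1 \<notin> A" "odd (a + below A a)"
      by (elim exE conjE)
    have "C \<in> part_chains P"
      unfolding part_chains_iff[OF assms(1)]
    proof (intro exI conjI)
      show "C = progression (2 * a + 1) k" by (rule C)
      show "C \<subseteq> P" unfolding C sub by (rule A(1))
      show "2 * a + 1 + 2 * Suc k \<notin> P" "2 * a + 1 \<ge> 2 \<longrightarrow> 2 * a + 1 - 2 \<notin> P"
        unfolding next_iff prev by fact+
    qed
    moreover have "\<forall>p\<in>C. odd p"
      by (auto simp: C progression_def)
    moreover have "Min C \<ge> 3"
      using pos[OF A(4)] by (simp add: C Min_progression)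
    ultimately show ?L
      using A(4) unfolding C Min_progression cong by (intro conjI)
  qed
qed

text \<open>Each chain of weight 2 is matched with the number following its run, which is
  \<open>(Max C + 1) div 2\<close>.\<close>

lemma partition_weight_eq:
  assumes "finite P"
  shows "partition_weight P = 2 ^ card (marked_ends (odd_half P))"
proof -
  let ?A = "odd_half P"
  define D where "D = {C \<in> part_chains P. (\<forall>p\<in>C. odd p) \<and> Min C \<ge> 3 \<and>
      [int (Min C) = 2 * int (num_odd_below (Min C) P) - 1] (mod 4)}"
  have D: "C \<in> D \<longleftrightarrow> (\<exists>a k. C = progression (2 * a + 1) k \<and> (\<forall>i\<le>k. a + i \<in> ?A) \<and>
      a + Suc k \<notin> ?A \<and> (a > 0 \<longrightarrow> a - 1 \<notin> ?A) \<and> odd (a + below ?A a))" for C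
    unfolding D_def using weighty_chain_iff[OF assms] by simp
  have finA: "finite ?A" using assms finite_halves by blast
  have "part_chains P \<subseteq> Pow P"
    by (auto simp: part_chains_def diff2_string_def)
  then have "finite (part_chains P)"
    using assms finite_subset by blast
  then have "partition_weight P = 2 ^ card D"
    unfolding partition_weight_def chain_weight_def by (simp add: prod.If_cases D_def Int_def)
  also have "bij_betw (\<lambda>C. (Max C + 1) div 2) D (marked_ends ?A)"
  proof (rule bij_betw_imageI)
    have end_eq: "(Max (progression (2 * a + 1) k) + 1) div 2 = a + Suc k" for a k
      by (simp add: Max_progression)
    \<comment> \<open>For two runs with the same end, a later start \<open>b\<close> would have
      \<open>b - 1\<close> in the other run.\<close>
    have le: "b \<le> a" if "\<forall>i\<le>k. a + i \<in> ?A" "b > 0 \<longrightarrow> b - 1 \<notin> ?A" "a + k = b + l" for a b k l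
    proof (rule ccontr)
      assume "\<not> b \<le> a"
      with that(1)[rule_format, of "b - 1 - a"] that(2,3) show False by auto
    qed
    show "inj_on (\<lambda>C. (Max C + 1) div 2) D"
    proof (rule inj_onI)
      fix C C' assume CD: "C \<in> D" and CD': "C' \<in> D"
        and eq: "(Max C + 1) div 2 = (Max C' + 1) div 2"
      obtain a k where C: "C = progression (2 * a + 1) k" "\<forall>i\<le>k. a + i \<in> ?A"
          "a > 0 \<longrightarrow> a - 1 \<notin> ?A"
        using CD unfolding D by (elim exE conjE)
      obtain b l where C': "C' = progression (2 * b + 1) l" "\<forall>i\<le>l. b + i \<in> ?A"
          "b > 0 \<longrightarrow> b - 1 \<notin> ?A"
        using CD' unfolding D by (elim exE conjE)
      have sum_eq: "a + k = b + l" using eq unfolding C(1) C'(1) end_eq by simp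
      have "a = b" "k = l"
        using sum_eq le[OF C(2) C'(3) sum_eq] le[OF C'(2) C(3) sum_eq[symmetric]] by simp_all
      then show "C = C'"
        using C(1) C'(1) by simp
    qed
    show "(\<lambda>C. (Max C + 1) div 2) ` D = marked_ends ?A"
    proof (intro equalityI subsetI)
      fix g assume "g \<in> (\<lambda>C. (Max C + 1) div 2) ` D"
      then obtain C where CD: "C \<in> D" and gC: "g = (Max C + 1) div 2" by blast
      obtain a k where C: "C = progression (2 * a + 1) k" "\<forall>i\<le>k. a + i \<in> ?A"
        "a + Suc k \<notin> ?A" "odd (a + below ?A a)"
        using CD unfolding D by (elim exE conjE)
      moreover have "g = a + Suc k"
        using gC unfolding C(1) end_eq .
      ultimately show "g \<in> marked_ends ?A"
        using below_add[OF finA, of "Suc k" a] by (auto simp: marked_ends_def less_Suc_eq_le)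
    next
      fix g assume "g \<in> marked_ends ?A"
      then have g: "g \<notin> ?A" "g - 1 \<in> ?A" "odd (g + below ?A g)"
        by (auto simp: marked_ends_def)
      then have "g > 0" by (cases g) auto
      let ?Q = "\<lambda>a. \<forall>x. a \<le> x \<and> x < g \<longrightarrow> x \<in> ?A"
      \<comment> \<open>The start of the maximal run ending at \<open>g - 1\<close>.\<close>
      define a where "a = (LEAST a. ?Q a)"
      have Q: "\<forall>x. g - 1 \<le> x \<and> x < g \<longrightarrow> x \<in> ?A"
      proof (intro allI impI)
        fix x assume "g - 1 \<le> x \<and> x < g"
        then have "x = g - 1" by linarith
        then show "x \<in> ?A" using g(2) by simp
      qed
      have a: "\<forall>x. a \<le> x \<and> x < g \<longrightarrow> x \<in> ?A"
        unfolding a_def using Q by (rule LeastI[where P = ?Q])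
      have "a \<le> g - 1"
        unfolding a_def using Q by (rule Least_le[where P = ?Q])
      then obtain k where k: "g = a + Suc k"
        using \<open>g > 0\<close> less_iff_Suc_add[of a g] by auto
      have "a - 1 \<notin> ?A" if "a > 0"
      proof
        assume "a - 1 \<in> ?A"
        have "\<forall>x. a - 1 \<le> x \<and> x < g \<longrightarrow> x \<in> ?A"
        proof (intro allI impI)
          fix x assume "a - 1 \<le> x \<and> x < g"
          then have "x = a - 1 \<or> a \<le> x \<and> x < g" by linarith
          then show "x \<in> ?A" using a \<open>a - 1 \<in> ?A\<close> by blast
        qed
        then have "a \<le> a - 1"
          unfolding a_def by (rule Least_le[where P = ?Q])
        then show False using that by simp
      qed
      \<comment> \<open>Along the run both the position and the count grow by \<open>Suc k\<close>,
        so the parity at the start agrees with that at \<open>g\<close>.\<close>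
      moreover have "below ?A g = below ?A a + Suc k"
        using below_add[OF finA, of "Suc k" a] a k by simp
      then have "odd (a + below ?A a)"
        using g(3) k by presburger
      moreover have "\<forall>i\<le>k. a + i \<in> ?A" "a + Suc k \<notin> ?A"
        using a g(1) k by simp_all
      ultimately have "progression (2 * a + 1) k \<in> D"
        unfolding D by blast
      then show "g \<in> (\<lambda>C. (Max C + 1) div 2) ` D"
        unfolding k end_eq[symmetric] by (rule imageI)
    qed
  qed
  then have "card D = card (marked_ends ?A)"
    by (rule bij_betw_same_card)
  finally show ?thesis .
qed

section \<open>Counting\<close>

text \<open>An even part avoids multiples of 4 iff its half is odd, which also excludes the part
  0.\<close>

lemma Q0_eq_card_pairs:
  "Q0 n = card {(B, V). finite B \<and> finite V \<and> (\<forall>v\<in>V. odd v) \<and> 2 * \<Sum>B + card B + 2 * \<Sum>V = n}"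
    (is "_ = card ?X")
proof -
  have X0: "distinct_partition P \<and> (\<forall>p\<in>P. \<not> [p = 0] (mod 4)) \<longleftrightarrow>
      finite P \<and> (\<forall>v\<in>even_half P. odd v)" for P
  proof -
    have "(\<not> [p = 0] (mod 4)) \<longleftrightarrow> (\<forall>v. p = 2 * v \<longrightarrow> odd v)" for p :: nat
      unfolding cong_def by presburger
    then have "(\<forall>p\<in>P. \<not> [p = 0] (mod 4)) \<longleftrightarrow> (\<forall>v\<in>even_half P. odd v)"
      by (auto simp: even_half_def)
    moreover have "\<forall>p\<in>P. p > 0" if "\<forall>v\<in>even_half P. odd v"
      using bspec[OF that, of 0] by (auto simp: even_half_def intro!: gr0I)
    ultimately show ?thesis by (auto simp: distinct_partition_def)
  qed
  have Q0: "Q0 n = card {P. finite P \<and> (\<forall>v\<in>even_half P. odd v) \<and> \<Sum>P = n}" (is "_ = card ?Y")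
    unfolding Q0_def conj_assoc[symmetric] X0 by (rule refl)
  have "bij_betw (\<lambda>(B, V). join B V) ?X ?Y"
  proof (rule bij_betw_byWitness[where f' = "\<lambda>P. (odd_half P, even_half P)"])
    show "\<forall>x\<in>?X. (\<lambda>P. (odd_half P, even_half P)) ((\<lambda>(B, V). join B V) x) = x"
      by (simp add: split_beta)
    show "\<forall>P\<in>?Y. (\<lambda>(B, V). join B V) (odd_half P, even_half P) = P"
      by simp
    show "(\<lambda>(B, V). join B V) ` ?X \<subseteq> ?Y"
    proof (rule image_subsetI)
      fix x assume x: "x \<in> ?X"
      obtain B V where eq: "x = (B, V)" by (cases x)
      show "(\<lambda>(B, V). join B V) x \<in> ?Y"
        using x unfolding eq by (simp add: sum_join finite_join_iff)
    qed
    show "(\<lambda>P. (odd_half P, even_half P)) ` ?Y \<subseteq> ?X"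
    proof (rule image_subsetI)
      fix P assume P: "P \<in> ?Y"
      then have fin: "finite (odd_half P)" "finite (even_half P)"
        using finite_halves by simp_all
      show "(odd_half P, even_half P) \<in> ?X"
        using P fin sum_join[OF fin] by simp
    qed
  qed
  from bij_betw_same_card[OF this] show ?thesis
    using Q0 by simp
qed

text \<open>\<open>V\<close> is kept and \<open>A\<close> is replaced by
  \<open>rotate_all V A\<close>. Rotations preserve \<open>card A\<close>, and
  \<open>sum_rotate_all\<close> trades the costs for the indices.\<close>

lemma card_pairs_rotate:
  "card {(A, V). finite A \<and> finite V \<and> (\<forall>v\<in>V. odd v) \<and>
      2 * \<Sum>A + card A + 2 * (\<Sum>v\<in>V. mark_cost A (gap A v)) = n}
   = card {(B, V). finite B \<and> finite V \<and> (\<forall>v\<in>V. odd v) \<and> 2 * \<Sum>B + card B + 2 * \<Sum>V = n}"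
    (is "card ?X = card ?Y")
proof (rule bij_betw_same_card)
  have bij: "bij_betw (rotate_all V) {A. finite A} {A. finite A}" for V
    unfolding rotate_all_def by (rule bij_betw_fold_step)
  have stat: "2 * \<Sum>(rotate_all V A) + card (rotate_all V A) + 2 * \<Sum>V
      = 2 * \<Sum>A + card A + 2 * (\<Sum>v\<in>V. mark_cost A (gap A v))"
    if "finite A" "finite V" "\<forall>v\<in>V. odd v" for A V
  proof -
    have "\<forall>v\<in>V. v > 0" using that(3) odd_pos by blast
    from sum_rotate_all[OF that(1,2) this] show ?thesis
      by (simp add: rotate_all_def card_fold_step)
  qed
  show "bij_betw (\<lambda>(A, V). (rotate_all V A, V)) ?X ?Y"
  proof (rule bij_betw_imageI)
    show "inj_on (\<lambda>(A, V). (rotate_all V A, V)) ?X"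
    proof (rule inj_onI)
      fix x y assume x: "x \<in> ?X" and y: "y \<in> ?X"
        and eq: "(\<lambda>(A, V). (rotate_all V A, V)) x = (\<lambda>(A, V). (rotate_all V A, V)) y"
      obtain A V A' where xy: "x = (A, V)" "y = (A', V)" "rotate_all V A = rotate_all V A'"
        using eq by (cases x, cases y) auto
      have "finite A" "finite A'" using x y xy by auto
      then have "A = A'"
        using inj_onD[OF bij_betw_imp_inj_on[OF bij] xy(3)] by simp
      then show "x = y" using xy by simp
    qed
    show "(\<lambda>(A, V). (rotate_all V A, V)) ` ?X = ?Y"
    proof (intro equalityI subsetI)
      fix x assume "x \<in> (\<lambda>(A, V). (rotate_all V A, V)) ` ?X"
      then show "x \<in> ?Y"
        using stat bij_betwE[OF bij] by auto
    next
      fix x assume x: "x \<in> ?Y"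
      obtain B V where eq: "x = (B, V)" by (cases x)
      have BV: "finite B" "finite V" "\<forall>v\<in>V. odd v" "2 * \<Sum>B + card B + 2 * \<Sum>V = n"
        using x unfolding eq by auto
      have "B \<in> rotate_all V ` {A. finite A}"
        using BV(1) bij_betw_imp_surj_on[OF bij] by simp
      then obtain A where A: "finite A" "rotate_all V A = B"
        by blast
      have "(A, V) \<in> ?X"
        using A BV stat[OF A(1) BV(2,3)] by simp
      then show "x \<in> (\<lambda>(A, V). (rotate_all V A, V)) ` ?X"
        using A(2) eq by (auto intro: image_eqI[where x = "(A, V)"])
    qed
  qed
qed

lemma card_pairs_gap:
  "card {(A, V). finite A \<and> finite V \<and> (\<forall>v\<in>V. odd v) \<and>
      2 * \<Sum>A + card A + 2 * (\<Sum>v\<in>V. mark_cost A (gap A v)) = n}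
   = card {(A, H). finite A \<and> finite H \<and> (\<forall>g\<in>H. g \<notin> A \<and> odd (g + below A g)) \<and>
      2 * \<Sum>A + card A + 2 * (\<Sum>g\<in>H. mark_cost A g) = n}"
    (is "card ?X = card ?Y")
proof (rule bij_betw_same_card)
  have inj: "inj (gap A)" if "finite A" for A
    using strict_mono_gap[OF that] by (rule strict_mono_imp_inj_on)
  have odd_iff: "odd (gap A v + below A (gap A v)) \<longleftrightarrow> odd v" if "finite A" for A v
    using gap_eq_add_below[OF that, of v] by presburger
  have sum_gap: "(\<Sum>g\<in>gap A ` V. mark_cost A g) = (\<Sum>v\<in>V. mark_cost A (gap A v))"
    if "finite A" for A V
    using inj[OF that] by (simp add: sum.reindex inj_on_subset)
  show "bij_betw (\<lambda>(A, V). (A, gap A ` V)) ?X ?Y"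
  proof (rule bij_betw_imageI)
    show "inj_on (\<lambda>(A, V). (A, gap A ` V)) ?X"
    proof (rule inj_onI)
      fix x y assume x: "x \<in> ?X"
        and eq: "(\<lambda>(A, V). (A, gap A ` V)) x = (\<lambda>(A, V). (A, gap A ` V)) y"
      obtain A V V' where xy: "x = (A, V)" "y = (A, V')" "gap A ` V = gap A ` V'"
        using eq by (cases x, cases y) auto
      have "finite A" using x xy by auto
      then have "V = V'"
        using inj_image_eq_iff[OF inj] xy(3) by simp
      then show "x = y" using xy by simp
    qed
    show "(\<lambda>(A, V). (A, gap A ` V)) ` ?X = ?Y"
    proof (intro equalityI subsetI)
      fix x assume "x \<in> (\<lambda>(A, V). (A, gap A ` V)) ` ?X"
      then obtain y where y: "y \<in> ?X" and xy: "x = (\<lambda>(A, V). (A, gap A ` V)) y"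
        by (elim imageE)
      obtain A V where eq: "y = (A, V)" by (cases y)
      have AV: "finite A" "finite V" "\<forall>v\<in>V. odd v"
        "2 * \<Sum>A + card A + 2 * (\<Sum>v\<in>V. mark_cost A (gap A v)) = n"
        using y unfolding eq by simp_all
      have "g \<notin> A \<and> odd (g + below A g)" if "g \<in> gap A ` V" for g
        using that AV(3) gap_notin[OF AV(1)] odd_iff[OF AV(1)] by blast
      then show "x \<in> ?Y"
        using AV sum_gap[OF AV(1)] unfolding xy eq by simp
    next
      fix x assume x: "x \<in> ?Y"
      obtain A H where eq: "x = (A, H)" by (cases x)
      have AH: "finite A" "finite H" "\<And>g. g \<in> H \<Longrightarrow> g \<notin> A"
        "\<And>g. g \<in> H \<Longrightarrow> odd (g + below A g)"
        "2 * \<Sum>A + card A + 2 * (\<Sum>g\<in>H. mark_cost A g) = n"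
        using x unfolding eq by auto
      define V where "V = gap A -` H"
      have H: "H = gap A ` V"
        unfolding V_def using gap_surj[OF AH(1)] AH(3) by blast
      moreover have "finite V"
        unfolding V_def using AH(2) inj[OF AH(1)] by (rule finite_vimageI)
      moreover have "\<forall>v\<in>V. odd v"
        using AH(4) odd_iff[OF AH(1)] by (auto simp: V_def)
      ultimately have "(A, V) \<in> ?X"
        using AH(1,5) sum_gap[OF AH(1)] by simp
      then show "x \<in> (\<lambda>(A, V). (A, gap A ` V)) ` ?X"
        using H eq by (auto intro: image_eqI[where x = "(A, V)"])
    qed
  qed
qed

lemma sum_mark_cost: "finite H \<Longrightarrow> (\<Sum>g\<in>H. mark_cost A g) = \<Sum>{g \<in> H. g - 1 \<notin> A}"
  unfolding mark_cost_def by (subst sum.inter_filter) (auto intro!: sum.cong)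

lemma card_marked_S_star:
  "card (SIGMA P:{P. P \<in> S_star \<and> \<Sum>P = n}. Pow (marked_ends (odd_half P)))
   = card {(A, H). finite A \<and> finite H \<and> (\<forall>g\<in>H. g \<notin> A \<and> odd (g + below A g)) \<and>
      2 * \<Sum>A + card A + 2 * (\<Sum>g\<in>H. mark_cost A g) = n}"
    (is "card ?X = card ?Y")
proof (rule bij_betw_same_card)
  let ?f = "\<lambda>(P, M). (odd_half P, even_half P \<union> M)"
  let ?f' = "\<lambda>(A, H). (join A {g \<in> H. g - 1 \<notin> A}, {g \<in> H. g - 1 \<in> A})"
  have split_eq: "{g \<in> even_half P \<union> M. g - 1 \<notin> odd_half P} = even_half P"
    "{g \<in> even_half P \<union> M. g - 1 \<in> odd_half P} = M"
    if "P \<in> S_star" "M \<subseteq> marked_ends (odd_half P)" for P M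
    using that by (auto simp: S_star_iff marked_ends_def)
  show "bij_betw ?f ?X ?Y"
  proof (rule bij_betw_byWitness[where f' = ?f'])
    show "\<forall>x\<in>?X. ?f' (?f x) = x"
    proof
      fix x assume "x \<in> ?X"
      then obtain P M where x: "x = (P, M)" and PM: "P \<in> S_star" "M \<subseteq> marked_ends (odd_half P)"
        by blast
      show "?f' (?f x) = x"
        by (simp only: x prod.case split_eq[OF PM] join_halves)
    qed
    show "\<forall>y\<in>?Y. ?f (?f' y) = y"
    proof
      fix y assume "y \<in> ?Y"
      obtain A H where y: "y = (A, H)" by (cases y)
      have "{g \<in> H. g - 1 \<notin> A} \<union> {g \<in> H. g - 1 \<in> A} = H" by blast
      then show "?f (?f' y) = y"
        by (simp only: y prod.case odd_half_join even_half_join)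
    qed
    show "?f ` ?X \<subseteq> ?Y"
    proof (rule image_subsetI)
      fix x assume "x \<in> ?X"
      then obtain P M where x: "x = (P, M)" and P: "P \<in> S_star" "\<Sum>P = n"
        and M: "M \<subseteq> marked_ends (odd_half P)"
        by blast
      have fin: "finite (odd_half P)" "finite (even_half P)"
        using P(1) finite_halves by (simp_all add: S_star_iff)
      have "finite M"
        using M finite_marked_ends[OF fin(1)] finite_subset by blast
      then have "(\<Sum>g\<in>even_half P \<union> M. mark_cost (odd_half P) g) = \<Sum>(even_half P)"
        using fin split_eq(1)[OF P(1) M] by (simp add: sum_mark_cost)
      moreover have "n = 2 * \<Sum>(odd_half P) + card (odd_half P) + 2 * \<Sum>(even_half P)"
        using sum_join[OF fin] P(2) by simp
      moreover have "g \<notin> odd_half P \<and> odd (g + below (odd_half P) g)"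
        if "g \<in> even_half P \<union> M" for g
        using that P(1) M unfolding S_star_iff marked_ends_def by blast
      ultimately show "?f x \<in> ?Y"
        using fin \<open>finite M\<close> unfolding x by simp
    qed
    show "?f' ` ?Y \<subseteq> ?X"
    proof (rule image_subsetI)
      fix y assume y: "y \<in> ?Y"
      obtain A H where eq: "y = (A, H)" by (cases y)
      have AH: "finite A" "finite H" "\<forall>g\<in>H. g \<notin> A \<and> odd (g + below A g)"
        "2 * \<Sum>A + card A + 2 * (\<Sum>g\<in>H. mark_cost A g) = n"
        using y unfolding eq by auto
      have "join A {g \<in> H. g - 1 \<notin> A} \<in> S_star"
        using AH(1-3) by (simp add: S_star_iff finite_join_iff)
      moreover have "\<Sum>(join A {g \<in> H. g - 1 \<notin> A}) = n"
        using AH by (simp add: sum_join sum_mark_cost)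
      moreover have "{g \<in> H. g - 1 \<in> A} \<subseteq> marked_ends A"
        using AH(3) by (auto simp: marked_ends_def)
      ultimately show "?f' y \<in> ?X"
        unfolding eq by simp
    qed
  qed
qed

theorem theorem4:
  fixes n :: nat
  shows "Q0 n = (\<Sum>P | P \<in> S_star \<and> \<Sum>P = n. partition_weight P)"
proof -
  let ?S = "{P. P \<in> S_star \<and> \<Sum>P = n}"
  have fin: "finite P" if "P \<in> ?S" for P
    using that by (simp add: S_star_iff)
  have "?S \<subseteq> Pow {..n}"
  proof (intro subsetI PowI)
    fix P p assume P: "P \<in> ?S" and "p \<in> P"
    then have "p \<le> \<Sum>P"
      using fin[OF P] by (intro member_le_sum) simp_all
    then show "p \<in> {..n}" using P by simp
  qed
  then have finS: "finite ?S"
    using finite_subset by blast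
  have fin_ends: "finite (marked_ends (odd_half P))" if "P \<in> ?S" for P
    using fin[OF that] finite_halves finite_marked_ends by blast
  have "(\<Sum>P\<in>?S. partition_weight P) = (\<Sum>P\<in>?S. card (Pow (marked_ends (odd_half P))))"
    using fin fin_ends by (intro sum.cong) (simp_all add: partition_weight_eq card_Pow)
  also have "\<dots> = card (SIGMA P:?S. Pow (marked_ends (odd_half P)))"
    using finS fin_ends by (intro card_SigmaI[symmetric]) auto
  also have "\<dots> = Q0 n"
    unfolding card_marked_S_star Q0_eq_card_pairs card_pairs_rotate[symmetric] card_pairs_gap ..
  finally show ?thesis ..
qed

end
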